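(* Let $P_1$ and $P_2$ be two logic programs. Then $P_1$ and $P_2$ are strongly equivalent with respect to the min-answer set semantics (i.e. for every logic program $P$, the programs $P_1\cup P$ and $P_2\cup P$ have exactly the same min-answer sets) if and only if $P_1$ and $P_2$ are equivalent in Gödel's three-valued logic $G_3$.
   Context: Formulas are propositional over atoms with $\land,\lor,\leftarrow$ (implication, $H\leftarrow B$ meaning "$B$ implies $H$") and $\bot$; $\neg F$ abbreviates $\bot\leftarrow F$, $\top$ abbreviates $\bot\leftarrow\bot$. A logic program is a finite set of formulas; $\sigma_P$ is the set of atoms occurring in $P$. Answer sets of a logic program $P$: a set of atoms $M$ is an answer set of $P$ if $P\cup\{\neg a:a\in\sigma_P\setminus M\}\cup\{\neg\neg a:a\in M\}$ is consistent in intuitionistic logic and intuitionistically proves every atom of $M$ (for augmented programs, i.e. sets of clauses $H\leftarrow B$ with $H,B$ built from atoms, $\bot,\top$ by $\land,\lor,\neg$, this coincides with the usual reduct-based definition of answer sets for programs with nested expressions). A set of atoms $M$ is a model of $P$ if the classical interpretation making exactly the atoms of $M$ true satisfies all formulas of $P$; a minimal model if no proper subset is a model. A min-answer set is a set that is both an answer set and a minimal model. Gödel's logic $G_3$: interpretations assign to atoms values in $\{0,1,2\}$, extended by $I(A\land B)=\min(I(A),I(B))$, $I(A\lor B)=\max(I(A),I(B))$, $I(\bot)=0$, $I(B\leftarrow A)=2$ if $I(A)\le I(B)$ and $I(B)$ otherwise. $I$ models a program if every formula gets value 2. $T\vdash_{G_3}F$ means $(F_1\land\dots\land F_n)\to F$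 gets value 2 under every interpretation for some $F_i\in T$; $P_1$ and $P_2$ are equivalent in $G_3$ if $P_1\vdash_{G_3}F$ for all $F\in P_2$ and $P_2\vdash_{G_3}F$ for all $F\in P_1$. *)

theory Defs
  imports Main
begin

section \<open>Formulas and programs\<close>

text \<open>\<open>Imp B H\<close> is the formula \<open>H \<leftarrow> B\<close>: the body is the first argument.\<close>

datatype (atoms: 'a) form =
    Atom 'a
  | Bot
  | And "'a form" "'a form"
  | Or "'a form" "'a form"
  | Imp "'a form" "'a form"

abbreviation Neg :: "'a form \<Rightarrow> 'a form" where
  "Neg F \<equiv> Imp F Bot"

abbreviation Top :: "'a form" where
  "Top \<equiv> Imp Bot Bot"

definition logic_program :: "'a form set \<Rightarrow> bool" where
  "logic_program P \<longleftrightarrow> finite P"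

definition signature :: "'a form set \<Rightarrow> 'a set" where
  "signature P = (\<Union>F\<in>P. atoms F)"


section \<open>Intuitionistic provability\<close>

text \<open>Natural deduction; the set of hypotheses may be infinite.\<close>

inductive int_proves :: "'a form set \<Rightarrow> 'a form \<Rightarrow> bool" (infix "\<turnstile>\<^sub>I" 50) where
  Assm: "F \<in> \<Gamma> \<Longrightarrow> \<Gamma> \<turnstile>\<^sub>I F"
| BotE: "\<Gamma> \<turnstile>\<^sub>I Bot \<Longrightarrow> \<Gamma> \<turnstile>\<^sub>I F"
| AndI: "\<Gamma> \<turnstile>\<^sub>I F \<Longrightarrow> \<Gamma> \<turnstile>\<^sub>I G \<Longrightarrow> \<Gamma> \<turnstile>\<^sub>I And F G"
| AndE1: "\<Gamma> \<turnstile>\<^sub>I And F G \<Longrightarrow> \<Gamma> \<turnstile>\<^sub>I F"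
| AndE2: "\<Gamma> \<turnstile>\<^sub>I And F G \<Longrightarrow> \<Gamma> \<turnstile>\<^sub>I G"
| OrI1: "\<Gamma> \<turnstile>\<^sub>I F \<Longrightarrow> \<Gamma> \<turnstile>\<^sub>I Or F G"
| OrI2: "\<Gamma> \<turnstile>\<^sub>I G \<Longrightarrow> \<Gamma> \<turnstile>\<^sub>I Or F G"
| OrE: "\<Gamma> \<turnstile>\<^sub>I Or F G \<Longrightarrow> insert F \<Gamma> \<turnstile>\<^sub>I H \<Longrightarrow> insert G \<Gamma> \<turnstile>\<^sub>I H \<Longrightarrow> \<Gamma> \<turnstile>\<^sub>I H"
| ImpI: "insert F \<Gamma> \<turnstile>\<^sub>I G \<Longrightarrow> \<Gamma> \<turnstile>\<^sub>I Imp F G"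
| ImpE: "\<Gamma> \<turnstile>\<^sub>I Imp F G \<Longrightarrow> \<Gamma> \<turnstile>\<^sub>I F \<Longrightarrow> \<Gamma> \<turnstile>\<^sub>I G"

definition int_consistent :: "'a form set \<Rightarrow> bool" where
  "int_consistent \<Gamma> \<longleftrightarrow> \<not> \<Gamma> \<turnstile>\<^sub>I Bot"


section \<open>Answer sets, minimal models and min-answer sets\<close>

definition completion :: "'a form set \<Rightarrow> 'a set \<Rightarrow> 'a form set" where
  "completion P M =
     P \<union> {Neg (Atom a) | a. a \<in> signature P - M} \<union> {Neg (Neg (Atom a)) | a. a \<in> M}"

definition answer_set :: "'a form set \<Rightarrow> 'a set \<Rightarrow> bool" where
  "answer_set P M \<longleftrightarrow>
     int_consistent (completion P M) \<and> (\<forall>a\<in>M. completion P M \<turnstile>\<^sub>I Atom a)"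

primrec sat :: "'a set \<Rightarrow> 'a form \<Rightarrow> bool" where
  "sat M (Atom a) \<longleftrightarrow> a \<in> M"
| "sat M Bot \<longleftrightarrow> False"
| "sat M (And F G) \<longleftrightarrow> sat M F \<and> sat M G"
| "sat M (Or F G) \<longleftrightarrow> sat M F \<or> sat M G"
| "sat M (Imp F G) \<longleftrightarrow> (sat M F \<longrightarrow> sat M G)"

definition model :: "'a form set \<Rightarrow> 'a set \<Rightarrow> bool" where
  "model P M \<longleftrightarrow> (\<forall>F\<in>P. sat M F)"

definition minimal_model :: "'a form set \<Rightarrow> 'a set \<Rightarrow> bool" where
  "minimal_model P M \<longleftrightarrow> model P M \<and> (\<forall>N. N \<subset> M \<longrightarrow> \<not> model P N)"

definition min_answer_set :: "'a form set \<Rightarrow> 'a set \<Rightarrow> bool" where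
  "min_answer_set P M \<longleftrightarrow> answer_set P M \<and> minimal_model P M"

definition strongly_equivalent_min :: "'a form set \<Rightarrow> 'a form set \<Rightarrow> bool" where
  "strongly_equivalent_min P1 P2 \<longleftrightarrow>
     (\<forall>P. logic_program P \<longrightarrow>
        {M. min_answer_set (P1 \<union> P) M} = {M. min_answer_set (P2 \<union> P) M})"


section \<open>The three-valued logic $G_3$\<close>

definition g3_interp :: "('a \<Rightarrow> nat) \<Rightarrow> bool" where
  "g3_interp I \<longleftrightarrow> (\<forall>a. I a \<in> {0, 1, 2})"

primrec g3_val :: "('a \<Rightarrow> nat) \<Rightarrow> 'a form \<Rightarrow> nat" where
  "g3_val I (Atom a) = I a"
| "g3_val I Bot = 0"
| "g3_val I (And F G) = min (g3_val I F) (g3_val I G)"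
| "g3_val I (Or F G) = max (g3_val I F) (g3_val I G)"
| "g3_val I (Imp F G) = (if g3_val I F \<le> g3_val I G then 2 else g3_val I G)"

definition g3_valid :: "'a form \<Rightarrow> bool" where
  "g3_valid F \<longleftrightarrow> (\<forall>I. g3_interp I \<longrightarrow> g3_val I F = 2)"

text \<open>The empty conjunction is read as \<open>Top\<close>, so that valid formulas follow from the
  empty theory.\<close>

definition conj_list :: "'a form list \<Rightarrow> 'a form" where
  "conj_list Fs = foldr And Fs Top"

definition g3_proves :: "'a form set \<Rightarrow> 'a form \<Rightarrow> bool" (infix "\<turnstile>\<^sub>G" 50) where
  "T \<turnstile>\<^sub>G F \<longleftrightarrow> (\<exists>Fs. set Fs \<subseteq> T \<and> g3_valid (Imp (conj_list Fs) F))"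

definition g3_equivalent :: "'a form set \<Rightarrow> 'a form set \<Rightarrow> bool" where
  "g3_equivalent P1 P2 \<longleftrightarrow> (\<forall>F\<in>P2. P1 \<turnstile>\<^sub>G F) \<and> (\<forall>F\<in>P1. P2 \<turnstile>\<^sub>G F)"

end

theory Submission
  imports Defs
begin

text \<open>
  Answer sets are equilibrium models: \<open>M\<close> is an answer set of \<open>P\<close> iff the two-valued
  interpretation \<open>(M, M)\<close> satisfies \<open>P\<close> in \<open>G\<^sub>3\<close> and no three-valued \<open>(N, M)\<close> with
  \<open>N \<subset> M\<close> does. Here \<open>(N, M)\<close> gives the value 2 on \<open>N\<close>, 1 on \<open>M - N\<close> and 0 elsewhere.
  Hence \<open>G\<^sub>3\<close>-equivalent programs have the same min-answer sets in every context.

  Conversely, let \<open>(N, M)\<close> satisfy \<open>P1\<close> but not \<open>P2\<close>. If \<open>M\<close> is not a model of \<open>P2\<close>, adding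
  the atoms of \<open>M\<close> as facts makes \<open>M\<close> a min-answer set of the first program only. Otherwise add
  the facts \<open>N\<close>, the implications between atoms of \<open>M - N\<close> and the formulas \<open>\<not>\<not>a\<close> for
  \<open>a \<in> M - N\<close>. The only interpretations \<open>(K, M)\<close> of this context are \<open>(N, M)\<close> and \<open>(M, M)\<close>,
  and the double negations keep \<open>N\<close> from being a classical model, so \<open>M\<close> is a min-answer set
  of the second program only.
\<close>

section \<open>Intuitionistic derivations\<close>

lemma int_proves_mono: "\<Gamma> \<turnstile>\<^sub>I F \<Longrightarrow> \<Gamma> \<subseteq> \<Delta> \<Longrightarrow> \<Delta> \<turnstile>\<^sub>I F"
proof (induction arbitrary: \<Delta> rule: int_proves.induct)
  case (OrE \<Gamma> F G H)
  have "insert F \<Gamma> \<subseteq> insert F \<Delta>" "insert G \<Gamma> \<subseteq> insert G \<Delta>" using OrE.prems by auto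
  then show ?case using OrE.IH OrE.prems int_proves.OrE by metis
next
  case (ImpI F \<Gamma> G)
  have "insert F \<Gamma> \<subseteq> insert F \<Delta>" using ImpI.prems by auto
  then show ?case using ImpI.IH int_proves.ImpI by metis
qed (blast intro: int_proves.intros)+

lemma int_proves_insert: "\<Gamma> \<turnstile>\<^sub>I F \<Longrightarrow> insert G \<Gamma> \<turnstile>\<^sub>I F"
  by (erule int_proves_mono) blast

lemma int_proves_hyp: "insert F \<Gamma> \<turnstile>\<^sub>I F"
  by (simp add: int_proves.Assm)

lemma int_proves_MP_insert: "\<Gamma> \<turnstile>\<^sub>I Imp F G \<Longrightarrow> insert H \<Gamma> \<turnstile>\<^sub>I F \<Longrightarrow> insert H \<Gamma> \<turnstile>\<^sub>I G"
  by (metis int_proves.ImpE int_proves_insert)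

lemma int_proves_K: "\<Gamma> \<turnstile>\<^sub>I G \<Longrightarrow> \<Gamma> \<turnstile>\<^sub>I Imp F G"
  by (intro int_proves.ImpI int_proves_insert)

lemma int_proves_Top: "\<Gamma> \<turnstile>\<^sub>I Top"
  by (intro int_proves.ImpI int_proves_hyp)

lemma int_proves_trans:
  assumes "\<Gamma> \<turnstile>\<^sub>I Imp F G" "\<Gamma> \<turnstile>\<^sub>I Imp G H"
  shows "\<Gamma> \<turnstile>\<^sub>I Imp F H"
  by (rule int_proves.ImpI)
    (meson assms int_proves_MP_insert int_proves_hyp)

section \<open>Provable equivalence over a theory as a congruence\<close>

definition int_equiv :: "'a form set \<Rightarrow> 'a form \<Rightarrow> 'a form \<Rightarrow> bool" where
  "int_equiv \<Gamma> F G \<longleftrightarrow> \<Gamma> \<turnstile>\<^sub>I Imp F G \<and> \<Gamma> \<turnstile>\<^sub>I Imp G F"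

lemma int_equiv_trans: "int_equiv \<Gamma> F G \<Longrightarrow> int_equiv \<Gamma> G H \<Longrightarrow> int_equiv \<Gamma> F H"
  unfolding int_equiv_def by (meson int_proves_trans)

lemma int_equiv_Top: "int_equiv \<Gamma> F Top \<longleftrightarrow> \<Gamma> \<turnstile>\<^sub>I F"
  unfolding int_equiv_def by (meson int_proves.ImpE int_proves_K int_proves_Top)

lemma int_equiv_Bot: "int_equiv \<Gamma> F Bot \<longleftrightarrow> \<Gamma> \<turnstile>\<^sub>I Neg F"
  unfolding int_equiv_def by (meson int_proves.BotE int_proves.ImpI int_proves_hyp)

lemma And_mono:
  assumes "\<Gamma> \<turnstile>\<^sub>I Imp F F'" "\<Gamma> \<turnstile>\<^sub>I Imp G G'"
  shows "\<Gamma> \<turnstile>\<^sub>I Imp (And F G) (And F' G')"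
  by (intro int_proves.ImpI int_proves.AndI
      int_proves_MP_insert[OF assms(1)] int_proves_MP_insert[OF assms(2)])
    (meson int_proves.AndE1 int_proves.AndE2 int_proves_hyp)+

lemma Or_least:
  assumes "\<Gamma> \<turnstile>\<^sub>I Imp F H" "\<Gamma> \<turnstile>\<^sub>I Imp G H"
  shows "\<Gamma> \<turnstile>\<^sub>I Imp (Or F G) H"
  by (rule int_proves.ImpI, rule int_proves.OrE[OF int_proves_hyp])
    (meson assms int_proves_insert int_proves_MP_insert int_proves_hyp)+

lemma Imp_OrI1: "\<Gamma> \<turnstile>\<^sub>I Imp F G \<Longrightarrow> \<Gamma> \<turnstile>\<^sub>I Imp F (Or G H)"
  by (meson int_proves.ImpI int_proves.OrI1 int_proves_MP_insert int_proves_hyp)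

lemma Imp_OrI2: "\<Gamma> \<turnstile>\<^sub>I Imp F H \<Longrightarrow> \<Gamma> \<turnstile>\<^sub>I Imp F (Or G H)"
  by (meson int_proves.ImpI int_proves.OrI2 int_proves_MP_insert int_proves_hyp)

lemma Imp_mono:
  assumes "\<Gamma> \<turnstile>\<^sub>I Imp F' F" "\<Gamma> \<turnstile>\<^sub>I Imp G G'"
  shows "\<Gamma> \<turnstile>\<^sub>I Imp (Imp F G) (Imp F' G')"
proof -
  have "insert (Imp F G) \<Gamma> \<turnstile>\<^sub>I Imp F' G'"
    using assms int_proves_trans int_proves_insert int_proves_hyp by metis
  then show ?thesis by (rule int_proves.ImpI)
qed

lemma int_equiv_And:
  "int_equiv \<Gamma> F F' \<Longrightarrow> int_equiv \<Gamma> G G' \<Longrightarrow> int_equiv \<Gamma> (And F G) (And F' G')"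
  unfolding int_equiv_def by (blast intro: And_mono)

lemma int_equiv_Or:
  "int_equiv \<Gamma> F F' \<Longrightarrow> int_equiv \<Gamma> G G' \<Longrightarrow> int_equiv \<Gamma> (Or F G) (Or F' G')"
  unfolding int_equiv_def by (blast intro: Or_least Imp_OrI1 Imp_OrI2)

lemma int_equiv_Imp:
  "int_equiv \<Gamma> F F' \<Longrightarrow> int_equiv \<Gamma> G G' \<Longrightarrow> int_equiv \<Gamma> (Imp F G) (Imp F' G')"
  unfolding int_equiv_def by (blast intro: Imp_mono)

lemma And_absorb: "\<Gamma> \<turnstile>\<^sub>I Imp F G \<Longrightarrow> int_equiv \<Gamma> (And F G) F \<and> int_equiv \<Gamma> (And G F) F"
  unfolding int_equiv_def
  by (meson int_proves.AndE1 int_proves.AndE2 int_proves.AndI int_proves.ImpI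
      int_proves_MP_insert int_proves_hyp)

lemma Or_absorb: "\<Gamma> \<turnstile>\<^sub>I Imp F G \<Longrightarrow> int_equiv \<Gamma> (Or F G) G \<and> int_equiv \<Gamma> (Or G F) G"
  unfolding int_equiv_def
  by (meson Or_least int_proves.ImpI int_proves.OrI1 int_proves.OrI2 int_proves_hyp)

lemma Imp_discharge: "\<Gamma> \<turnstile>\<^sub>I F \<Longrightarrow> int_equiv \<Gamma> (Imp F G) G"
  unfolding int_equiv_def
  by (meson int_proves.ImpE int_proves.ImpI int_proves_K int_proves_hyp int_proves_insert)


section \<open>Evaluation and derivability\<close>

text \<open>Stated for every threshold \<open>t\<close>: with \<open>t = 2\<close> alone the induction fails at the
  introduction of an implication whose premise has value 1.\<close>

lemma int_proves_sound:
  "\<Gamma> \<turnstile>\<^sub>I F \<Longrightarrow> t \<le> 2 \<Longrightarrow> (\<And>G. G \<in> \<Gamma> \<Longrightarrow> t \<le> g3_val I G) \<Longrightarrow> t \<le> g3_val I F"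
proof (induction arbitrary: t rule: int_proves.induct)
  case (BotE \<Gamma> F)
  then show ?case by fastforce
next
  case (OrE \<Gamma> F G H)
  have "t \<le> g3_val I F \<or> t \<le> g3_val I G" using OrE.IH(1) OrE.prems by fastforce
  then show ?case using OrE.IH(2,3) OrE.prems by blast
next
  case (ImpI F \<Gamma> G)
  \<comment> \<open>Lowering the threshold to the value of \<open>F\<close> makes the discharged
    hypothesis meet it. If \<open>F\<close> exceeds \<open>G\<close> in value, the resulting bound
    on \<open>G\<close> can only come from \<open>t\<close>.\<close>
  let ?t = "min t (g3_val I F)"
  have "?t \<le> g3_val I H" if "H \<in> insert F \<Gamma>" for H
    using that ImpI.prems(2)[of H] by auto
  then have "?t \<le> g3_val I G" using ImpI.IH[of ?t] ImpI.prems(1) by simp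
  then show ?case using ImpI.prems(1) by auto
next
  case (ImpE \<Gamma> F G)
  have "t \<le> g3_val I (Imp F G)" "t \<le> g3_val I F" using ImpE by blast+
  then show ?case by (auto split: if_splits)
qed fastforce+

section \<open>Pairs of atom sets as three-valued interpretations\<close>

lemma g3_val_cong: "(\<And>a. a \<in> atoms F \<Longrightarrow> I a = J a) \<Longrightarrow> g3_val I F = g3_val J F"
  by (induction F) auto

lemma g3_val_le_2: "g3_interp I \<Longrightarrow> g3_val I F \<le> 2"
  by (induction F) (auto simp: g3_interp_def le_Suc_eq numeral_2_eq_2)

definition ht_interp :: "'a set \<Rightarrow> 'a set \<Rightarrow> 'a \<Rightarrow> nat" where
  "ht_interp N M a = (if a \<in> N then 2 else if a \<in> M then 1 else 0)"

lemma g3_interp_ht: "g3_interp (ht_interp N M)"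
  by (simp add: g3_interp_def ht_interp_def)

text \<open>Identifying the values 1 and 2 is a homomorphism from the three-element chain onto the
  two-element Boolean algebra.\<close>

lemma g3_val_ht_pos: "N \<subseteq> M \<Longrightarrow> 0 < g3_val (ht_interp N M) F \<longleftrightarrow> sat M F"
  by (induction F) (auto simp: ht_interp_def)

lemma g3_val_ht_refl: "g3_val (ht_interp M M) F = (if sat M F then 2 else 0)"
  by (induction F) (auto simp: ht_interp_def)

definition ht_model :: "'a form set \<Rightarrow> 'a set \<Rightarrow> 'a set \<Rightarrow> bool" where
  "ht_model P N M \<longleftrightarrow> (\<forall>F\<in>P. g3_val (ht_interp N M) F = 2)"

lemma ht_model_Un: "ht_model (P \<union> Q) N M \<longleftrightarrow> ht_model P N M \<and> ht_model Q N M"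
  by (auto simp: ht_model_def)

lemma model_Un: "model (P \<union> Q) M \<longleftrightarrow> model P M \<and> model Q M"
  by (auto simp: model_def)

lemma ht_model_refl: "ht_model P M M \<longleftrightarrow> model P M"
  by (auto simp: ht_model_def model_def g3_val_ht_refl)

lemma ht_model_imp_model: "N \<subseteq> M \<Longrightarrow> ht_model P N M \<Longrightarrow> model P M"
  unfolding ht_model_def model_def by (metis g3_val_ht_pos zero_less_numeral)

text \<open>Formulas naming the truth values: \<open>D\<close> stands for 1, and \<open>Bot\<close>,
  \<open>D\<close>, \<open>Top\<close> form a chain under provable implication.\<close>

primrec value_form :: "'a form \<Rightarrow> nat \<Rightarrow> 'a form" where
  "value_form D 0 = Bot"
| "value_form D (Suc n) = (if n = 0 then D else Top)"

lemma value_form_simps [simp]: "value_form D 1 = D" "value_form D 2 = Top"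
  by (simp_all add: numeral_2_eq_2)

lemma value_form_mono:
  assumes "i \<le> j" "j \<le> 2"
  shows "\<Gamma> \<turnstile>\<^sub>I Imp (value_form D i) (value_form D j)"
proof -
  consider "i = 0" | "j = 2" | "i = 1" "j = 1" using assms by linarith
  then show ?thesis
  proof cases
    case 1
    then show ?thesis by (simp add: int_proves.BotE int_proves.ImpI int_proves_hyp)
  next
    case 2
    then show ?thesis by (simp add: int_proves_K int_proves_Top)
  next
    case 3
    then show ?thesis by (simp add: int_proves.ImpI int_proves_hyp)
  qed
qed

lemma value_form_And:
  assumes "i \<le> 2" "j \<le> 2"
  shows "int_equiv \<Gamma> (And (value_form D i) (value_form D j)) (value_form D (min i j))"
  using And_absorb[OF value_form_mono] assms by (cases "i \<le> j") (auto simp: min_def)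

lemma value_form_Or:
  assumes "i \<le> 2" "j \<le> 2"
  shows "int_equiv \<Gamma> (Or (value_form D i) (value_form D j)) (value_form D (max i j))"
  using Or_absorb[OF value_form_mono] assms by (cases "i \<le> j") (auto simp: max_def)

text \<open>Density of \<open>D\<close> enters in one entry of the truth table: 1 implies 0 has
  value 0, so \<open>Neg D\<close> must be refutable.\<close>

lemma value_form_Imp:
  assumes D: "\<Gamma> \<turnstile>\<^sub>I Neg (Neg D)" and "i \<le> 2" "j \<le> 2"
  shows "int_equiv \<Gamma> (Imp (value_form D i) (value_form D j))
    (value_form D (if i \<le> j then 2 else j))"
proof -
  consider "i \<le> j" | "i = 2" "j < i" | "i = 1" "j = 0" using assms by linarith
  then show ?thesis
  proof cases
    case 1
    then show ?thesis using value_form_mono assms(3) by (simp add: int_equiv_Top)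
  next
    case 2
    then show ?thesis using Imp_discharge[OF int_proves_Top] by simp
  next
    case 3
    then show ?thesis using D by (simp add: int_equiv_Bot)
  qed
qed

text \<open>A syntactic counterpart of the truth tables, in the manner of Kalmar's completeness
  proof: a theory that identifies all atoms of value 1 with one dense \<open>D\<close> decides every
  formula up to equivalence with \<open>Bot\<close>, \<open>D\<close> or \<open>Top\<close>.\<close>

lemma int_equiv_value_form:
  assumes D: "\<Gamma> \<turnstile>\<^sub>I Neg (Neg D)"
    and I: "g3_interp I"
    and at: "\<And>a. a \<in> atoms F \<Longrightarrow> int_equiv \<Gamma> (Atom a) (value_form D (I a))"
  shows "int_equiv \<Gamma> F (value_form D (g3_val I F))"
  using at
proof (induction F)
  case (Atom a)
  then show ?case by simp
next
  case Bot
  then show ?case by (simp add: int_equiv_Bot int_proves_Top)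
next
  case (And F G)
  have "int_equiv \<Gamma> F (value_form D (g3_val I F))" "int_equiv \<Gamma> G (value_form D (g3_val I G))"
    using And by simp_all
  then show ?case
    unfolding g3_val.simps
    by (intro int_equiv_trans[OF int_equiv_And value_form_And] g3_val_le_2 I)
next
  case (Or F G)
  have "int_equiv \<Gamma> F (value_form D (g3_val I F))" "int_equiv \<Gamma> G (value_form D (g3_val I G))"
    using Or by simp_all
  then show ?case
    unfolding g3_val.simps
    by (intro int_equiv_trans[OF int_equiv_Or value_form_Or] g3_val_le_2 I)
next
  case (Imp F G)
  have "int_equiv \<Gamma> F (value_form D (g3_val I F))" "int_equiv \<Gamma> G (value_form D (g3_val I G))"
    using Imp by simp_all
  then show ?case
    unfolding g3_val.simps
    by (intro int_equiv_trans[OF int_equiv_Imp value_form_Imp] g3_val_le_2 I D)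
qed


section \<open>Answer sets as equilibrium models\<close>

lemma atoms_subset_signature: "F \<in> P \<Longrightarrow> atoms F \<subseteq> signature P"
  by (auto simp: signature_def)

lemma finite_atoms: "finite (atoms F)"
  by (induction F) auto

lemma finite_signature: "finite P \<Longrightarrow> finite (signature P)"
  by (simp add: signature_def finite_atoms)

lemma ht_model_cong:
  assumes "\<And>a. a \<in> signature P \<Longrightarrow> a \<in> N \<longleftrightarrow> a \<in> N'"
    and "\<And>a. a \<in> signature P \<Longrightarrow> a \<in> M \<longleftrightarrow> a \<in> M'"
  shows "ht_model P N M \<longleftrightarrow> ht_model P N' M'"
proof -
  have "g3_val (ht_interp N M) F = g3_val (ht_interp N' M') F" if "F \<in> P" for F
    using atoms_subset_signature[OF that] assms
    by (intro g3_val_cong) (auto simp: ht_interp_def)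
  then show ?thesis by (simp add: ht_model_def)
qed

lemma completion_g3_val:
  assumes "ht_model P N M" "N \<subseteq> M" "F \<in> completion P M"
  shows "g3_val (ht_interp N M) F = 2"
  using assms by (auto simp: completion_def ht_model_def ht_interp_def)

lemma completion_sound:
  assumes "ht_model P N M" "N \<subseteq> M" "completion P M \<turnstile>\<^sub>I F"
  shows "2 \<le> g3_val (ht_interp N M) F"
  using int_proves_sound[OF assms(3), of 2 "ht_interp N M"] completion_g3_val[OF assms(1,2)]
  by simp

lemma answer_set_model:
  assumes "answer_set P M"
  shows "model P M"
  unfolding model_def
proof (intro ballI, rule ccontr)
  fix F assume F: "F \<in> P" and ns: "\<not> sat M F"
  let ?\<Gamma> = "completion P M"
  \<comment> \<open>On \<open>(M, M)\<close> no atom has value 1, so any dense formula can serve as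
    \<open>D\<close>; \<open>Top\<close> is the simplest.\<close>
  have "int_equiv ?\<Gamma> (Atom a) (value_form Top (ht_interp M M a))" if "a \<in> atoms F" for a
  proof (cases "a \<in> M")
    case True
    then show ?thesis using assms by (simp add: ht_interp_def int_equiv_Top answer_set_def)
  next
    case False
    then have "Neg (Atom a) \<in> ?\<Gamma>"
      using that atoms_subset_signature[OF F] by (auto simp: completion_def)
    then show ?thesis using False by (simp add: ht_interp_def int_equiv_Bot int_proves.Assm)
  qed
  moreover have "?\<Gamma> \<turnstile>\<^sub>I Neg (Neg Top)"
    by (meson int_proves.ImpE int_proves.ImpI int_proves_Top int_proves_hyp)
  ultimately have "int_equiv ?\<Gamma> F (value_form Top (g3_val (ht_interp M M) F))"
    by (intro int_equiv_value_form g3_interp_ht)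
  then have "?\<Gamma> \<turnstile>\<^sub>I Neg F" using ns by (simp add: g3_val_ht_refl int_equiv_Bot)
  moreover have "?\<Gamma> \<turnstile>\<^sub>I F" using F by (simp add: completion_def int_proves.Assm)
  ultimately show False
    using assms int_proves.ImpE unfolding answer_set_def int_consistent_def by metis
qed

text \<open>By soundness, the atoms provable from the completion have value 2 in every such
  \<open>(N, M)\<close>, which would put all of \<open>M\<close> into \<open>N\<close>.\<close>

lemma answer_set_no_smaller:
  assumes "answer_set P M" "N \<subset> M"
  shows "\<not> ht_model P N M"
proof
  assume "ht_model P N M"
  moreover obtain a where a: "a \<in> M" "a \<notin> N" using assms(2) by blast
  moreover have "completion P M \<turnstile>\<^sub>I Atom a" using assms(1) a by (simp add: answer_set_def)
  ultimately have "2 \<le> g3_val (ht_interp N M) (Atom a)" using assms(2) completion_sound by blast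
  then show False using a by (simp add: ht_interp_def)
qed

text \<open>Downward induction on \<open>N\<close>: if every larger set of facts already yields \<open>M\<close>, then the facts
  \<open>N\<close> make all atoms of \<open>M - N\<close> equivalent, and \<open>int_equiv_value_form\<close> applies to a formula of
  \<open>P\<close> that fails in \<open>(N, M)\<close>.\<close>

lemma completion_proves_atoms:
  assumes fin: "finite M" and mod: "model P M"
    and min: "\<And>N. N \<subset> M \<Longrightarrow> \<not> ht_model P N M"
  shows "N \<subseteq> M \<Longrightarrow> c \<in> M \<Longrightarrow> completion P M \<union> Atom ` N \<turnstile>\<^sub>I Atom c"
proof (induction "card (M - N)" arbitrary: N c rule: less_induct)
  case less
  let ?\<Gamma> = "completion P M \<union> Atom ` N"
  have N: "?\<Gamma> \<turnstile>\<^sub>I Atom a" if "a \<in> N" for a using that by (simp add: int_proves.Assm)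
  show ?case
  proof (cases "c \<in> N")
    case True
    then show ?thesis by (rule N)
  next
    case False
    have imp: "?\<Gamma> \<turnstile>\<^sub>I Imp (Atom a) (Atom b)" if "a \<in> M - N" "b \<in> M" for a b
    proof -
      have "card (M - insert a N) < card (M - N)"
        using that fin by (intro psubset_card_mono) auto
      then have "completion P M \<union> Atom ` insert a N \<turnstile>\<^sub>I Atom b"
        using less.hyps[of "insert a N" b] less.prems(1) that by blast
      then show ?thesis by (simp add: int_proves.ImpI)
    qed
    have "N \<subset> M" using False less.prems by blast
    then obtain F where F: "F \<in> P" and F2: "g3_val (ht_interp N M) F \<noteq> 2"
      using min unfolding ht_model_def by blast
    \<comment> \<open>The value of \<open>F\<close> is not 0 because \<open>M\<close> is a classical
      model, so it is 1. With \<open>c\<close> as \<open>D\<close>, the formula \<open>F\<close>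
      then becomes equivalent to the goal \<open>Atom c\<close> itself.\<close>
    have "0 < g3_val (ht_interp N M) F"
      using mod F g3_val_ht_pos[OF less.prems(1)] by (auto simp: model_def)
    then have F1: "g3_val (ht_interp N M) F = 1"
      using F2 g3_val_le_2[OF g3_interp_ht, of N M F] by linarith
    have "int_equiv ?\<Gamma> (Atom a) (value_form (Atom c) (ht_interp N M a))" if "a \<in> atoms F" for a
    proof -
      consider "a \<in> N" | "a \<in> M - N" | "a \<notin> M" by blast
      then show ?thesis
      proof cases
        case 1
        then show ?thesis using N by (simp add: ht_interp_def int_equiv_Top)
      next
        case 2
        then show ?thesis using imp False less.prems by (simp add: ht_interp_def int_equiv_def)
      next
        case 3
        then have "Neg (Atom a) \<in> completion P M"
          using that atoms_subset_signature[OF F] by (auto simp: completion_def)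
        moreover have "a \<notin> N" using 3 less.prems by blast
        ultimately show ?thesis
          using 3 by (simp add: ht_interp_def int_equiv_Bot int_proves.Assm)
      qed
    qed
    moreover have "?\<Gamma> \<turnstile>\<^sub>I Neg (Neg (Atom c))"
      using less.prems by (intro int_proves.Assm) (auto simp: completion_def)
    ultimately have "int_equiv ?\<Gamma> F (value_form (Atom c) (g3_val (ht_interp N M) F))"
      by (intro int_equiv_value_form g3_interp_ht)
    then have "?\<Gamma> \<turnstile>\<^sub>I Imp F (Atom c)" unfolding F1 by (simp add: int_equiv_def)
    moreover have "?\<Gamma> \<turnstile>\<^sub>I F" using F by (simp add: completion_def int_proves.Assm)
    ultimately show ?thesis by (rule int_proves.ImpE)
  qed
qed

theorem answer_set_iff_equilibrium:
  assumes "finite P"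
  shows "answer_set P M \<longleftrightarrow> model P M \<and> (\<forall>N. N \<subset> M \<longrightarrow> \<not> ht_model P N M)"
proof
  assume "answer_set P M"
  then show "model P M \<and> (\<forall>N. N \<subset> M \<longrightarrow> \<not> ht_model P N M)"
    by (simp add: answer_set_model answer_set_no_smaller)
next
  assume eq: "model P M \<and> (\<forall>N. N \<subset> M \<longrightarrow> \<not> ht_model P N M)"
  have refl: "ht_model P M M" using eq by (simp add: ht_model_refl)
  \<comment> \<open>Atoms foreign to \<open>P\<close> could be dropped from the first component
    without affecting \<open>P\<close>. This also gives finiteness of \<open>M\<close>, on which the
    induction over \<open>card (M - N)\<close> rests.\<close>
  have "M \<subseteq> signature P"
  proof (rule ccontr)
    assume "\<not> M \<subseteq> signature P"
    then have "M \<inter> signature P \<subset> M" by blast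
    moreover have "ht_model P (M \<inter> signature P) M"
      using refl by (subst ht_model_cong[where N' = M and M' = M]) auto
    ultimately show False using eq by blast
  qed
  then have "finite M" using finite_signature[OF assms] finite_subset by blast
  then have "completion P M \<turnstile>\<^sub>I Atom a" if "a \<in> M" for a
    using completion_proves_atoms[of M P "{}" a] eq that by simp
  moreover have "\<not> completion P M \<turnstile>\<^sub>I Bot"
    using completion_sound[OF refl order_refl] by fastforce
  ultimately show "answer_set P M" by (simp add: answer_set_def int_consistent_def)
qed

lemma min_answer_set_iff:
  assumes "finite P"
  shows "min_answer_set P M \<longleftrightarrow>
    model P M \<and> (\<forall>N. N \<subset> M \<longrightarrow> \<not> ht_model P N M \<and> \<not> model P N)"
  using answer_set_iff_equilibrium[OF assms]
  by (auto simp: min_answer_set_def minimal_model_def)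


section \<open>Consequence in \<open>G\<^sub>3\<close>\<close>

lemma g3_val_conj_list:
  assumes "t \<le> 2"
  shows "t \<le> g3_val I (conj_list Fs) \<longleftrightarrow> (\<forall>F\<in>set Fs. t \<le> g3_val I F)"
  using assms by (induction Fs) (auto simp: conj_list_def)

lemma g3_val_pos: "0 < g3_val I F \<longleftrightarrow> sat {a. 0 < I a} F"
  by (induction F) auto

lemma g3_interp_eq_ht:
  assumes "g3_interp I"
  shows "I = ht_interp {a. I a = 2} {a. 0 < I a}"
proof
  fix a
  have "I a \<in> {0, 1, 2}" using assms by (simp add: g3_interp_def)
  then show "I a = ht_interp {a. I a = 2} {a. 0 < I a} a" by (auto simp: ht_interp_def)
qed

lemma g3_proves_ht_model:
  assumes "T \<turnstile>\<^sub>G F" "ht_model T N M"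
  shows "g3_val (ht_interp N M) F = 2"
proof -
  let ?I = "ht_interp N M"
  obtain Fs where Fs: "set Fs \<subseteq> T" and v: "g3_valid (Imp (conj_list Fs) F)"
    using assms(1) by (auto simp: g3_proves_def)
  have "2 \<le> g3_val ?I (conj_list Fs)"
    using Fs assms(2) by (subst g3_val_conj_list) (auto simp: ht_model_def)
  moreover have "g3_val ?I (Imp (conj_list Fs) F) = 2"
    using v g3_interp_ht unfolding g3_valid_def by blast
  ultimately have "2 \<le> g3_val ?I F" by (auto split: if_splits)
  then show ?thesis using g3_val_le_2[OF g3_interp_ht, of N M F] by simp
qed

lemma g3_proves_if_consequence:
  assumes "finite T"
    and cons: "\<And>N M. N \<subseteq> M \<Longrightarrow> ht_model T N M \<Longrightarrow> g3_val (ht_interp N M) F = 2"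
  shows "T \<turnstile>\<^sub>G F"
proof -
  obtain Fs where Fs: "set Fs = T" using finite_list[OF assms(1)] by blast
  have "g3_val I (conj_list Fs) \<le> g3_val I F" if I: "g3_interp I" for I
  proof -
    let ?N = "{a. I a = 2}" and ?M = "{a. 0 < I a}"
    have sub: "?N \<subseteq> ?M" by auto
    have le: "g3_val I (conj_list Fs) \<le> 2" by (rule g3_val_le_2[OF I])
    then consider "g3_val I (conj_list Fs) = 0" | "g3_val I (conj_list Fs) = 1"
      | "g3_val I (conj_list Fs) = 2" by linarith
    then show ?thesis
    proof cases
      case 1
      then show ?thesis by simp
    next
      case 2
      then have "\<forall>G\<in>T. 1 \<le> g3_val I G" using g3_val_conj_list[of 1 I Fs] Fs by simp
      then have "\<forall>G\<in>T. sat ?M G" by (simp add: g3_val_pos[symmetric] Suc_le_eq)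
      \<comment> \<open>Premises of joint value 1 are not covered by \<open>cons\<close> at
        \<open>(?N, ?M)\<close>. Raising all nonzero atoms to 2 gives \<open>(?M, ?M)\<close>, where
        \<open>cons\<close> applies and shows that \<open>F\<close> is nonzero under
        \<open>I\<close>.\<close>
      then have "ht_model T ?M ?M" by (simp add: ht_model_refl model_def)
      then have "sat ?M F" using cons[of ?M ?M] by (simp add: g3_val_ht_refl split: if_splits)
      then have "0 < g3_val I F" by (simp add: g3_val_pos)
      then show ?thesis using 2 by simp
    next
      case 3
      then have "\<forall>G\<in>T. 2 \<le> g3_val I G" using g3_val_conj_list[of 2 I Fs] Fs by simp
      then have "\<forall>G\<in>T. g3_val I G = 2" using g3_val_le_2[OF I] by (simp add: eq_iff)
      then have "ht_model T ?N ?M"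
        unfolding ht_model_def g3_interp_eq_ht[OF I, symmetric] .
      then have "g3_val I F = 2"
        using cons[OF sub] unfolding g3_interp_eq_ht[OF I, symmetric] by blast
      then show ?thesis using 3 by simp
    qed
  qed
  then have "g3_valid (Imp (conj_list Fs) F)" by (simp add: g3_valid_def)
  then show ?thesis using Fs by (auto simp: g3_proves_def)
qed

lemma g3_equivalent_iff:
  assumes "finite P1" "finite P2"
  shows "g3_equivalent P1 P2 \<longleftrightarrow>
    (\<forall>N M. N \<subseteq> M \<longrightarrow> (ht_model P1 N M \<longleftrightarrow> ht_model P2 N M))"
proof
  assume "g3_equivalent P1 P2"
  then show "\<forall>N M. N \<subseteq> M \<longrightarrow> (ht_model P1 N M \<longleftrightarrow> ht_model P2 N M)"
    unfolding g3_equivalent_def using g3_proves_ht_model by (metis ht_model_def)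
next
  assume "\<forall>N M. N \<subseteq> M \<longrightarrow> (ht_model P1 N M \<longleftrightarrow> ht_model P2 N M)"
  then show "g3_equivalent P1 P2"
    unfolding g3_equivalent_def
    by (intro conjI ballI g3_proves_if_consequence assms) (auto simp: ht_model_def)
qed


section \<open>Separating contexts\<close>

lemma strongly_equivalent_min_sym:
  "strongly_equivalent_min P1 P2 \<Longrightarrow> strongly_equivalent_min P2 P1"
  by (simp add: strongly_equivalent_min_def)

lemma strongly_equivalent_minD:
  assumes "strongly_equivalent_min P1 P2" "finite P"
  shows "min_answer_set (P1 \<union> P) M \<longleftrightarrow> min_answer_set (P2 \<union> P) M"
  using assms by (auto simp: strongly_equivalent_min_def logic_program_def set_eq_iff)

lemma strongly_equivalent_min_model:
  assumes se: "strongly_equivalent_min P1 P2"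
    and fin: "finite P1" "finite P2" "finite M" and M: "model P1 M"
  shows "model P2 M"
proof -
  let ?P = "Atom ` M"
  have "\<not> ht_model (P1 \<union> ?P) N M \<and> \<not> model (P1 \<union> ?P) N" if N: "N \<subset> M" for N
  proof -
    obtain a where a: "a \<in> M" "a \<notin> N" using N by blast
    have "\<not> ht_model ?P N M" using a by (auto simp: ht_model_def ht_interp_def)
    moreover have "\<not> model ?P N" using a by (auto simp: model_def)
    ultimately show ?thesis by (simp add: model_Un ht_model_Un)
  qed
  moreover have "model (P1 \<union> ?P) M" using M by (auto simp: model_def)
  ultimately have "min_answer_set (P1 \<union> ?P) M" using fin by (simp add: min_answer_set_iff)
  then have "min_answer_set (P2 \<union> ?P) M" using strongly_equivalent_minD[OF se, of ?P] fin by simp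
  then show ?thesis using fin by (simp add: min_answer_set_iff model_Un)
qed

text \<open>The double negations hold in every \<open>(K, M)\<close> with \<open>K\<close> inside
  \<open>M\<close>, so they leave the three-valued condition unchanged; classically they act as the
  facts \<open>M - N\<close>.\<close>

definition separator :: "'a set \<Rightarrow> 'a set \<Rightarrow> 'a form set" where
  "separator N M = Atom ` N \<union> (\<lambda>(a, b). Imp (Atom a) (Atom b)) ` ((M - N) \<times> (M - N))
     \<union> (\<lambda>a. Neg (Neg (Atom a))) ` (M - N)"

lemma finite_separator: "finite M \<Longrightarrow> N \<subseteq> M \<Longrightarrow> finite (separator N M)"
  by (simp add: separator_def finite_subset)

lemma model_separator: "N \<subseteq> M \<Longrightarrow> K \<subseteq> M \<Longrightarrow> model (separator N M) K \<longleftrightarrow> K = M"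
  by (simp add: separator_def model_def ball_Un) blast

lemma ht_model_separator:
  assumes "N \<subseteq> M" "K \<subseteq> M"
  shows "ht_model (separator N M) K M \<longleftrightarrow> K = N \<or> K = M"
proof -
  have "ht_model (Atom ` N) K M \<longleftrightarrow> N \<subseteq> K"
    by (auto simp: ht_model_def ht_interp_def split: if_splits)
  moreover have "ht_model ((\<lambda>(a, b). Imp (Atom a) (Atom b)) ` ((M - N) \<times> (M - N))) K M
      \<longleftrightarrow> (\<forall>a\<in>M - N. \<forall>b\<in>M - N. a \<in> K \<longrightarrow> b \<in> K)"
    by (simp add: ht_model_def ht_interp_def)
  moreover have "ht_model ((\<lambda>a. Neg (Neg (Atom a))) ` (M - N)) K M"
    by (simp add: ht_model_def ht_interp_def)
  ultimately have "ht_model (separator N M) K M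
      \<longleftrightarrow> N \<subseteq> K \<and> (\<forall>a\<in>M - N. \<forall>b\<in>M - N. a \<in> K \<longrightarrow> b \<in> K)"
    by (simp add: separator_def ht_model_Un)
  then show ?thesis using assms by blast
qed

lemma strongly_equivalent_min_ht_model_finite:
  assumes se: "strongly_equivalent_min P1 P2"
    and fin: "finite P1" "finite P2" "finite M" and NM: "N \<subseteq> M" and ht: "ht_model P1 N M"
  shows "ht_model P2 N M"
proof (rule ccontr)
  assume not: "\<not> ht_model P2 N M"
  have M2: "model P2 M"
    by (rule strongly_equivalent_min_model[OF se fin ht_model_imp_model[OF NM ht]])
  have "N \<noteq> M" using not M2 ht_model_refl by metis
  then have "N \<subset> M" using NM by blast
  let ?P = "separator N M"
  have finP: "finite (P1 \<union> ?P)" "finite (P2 \<union> ?P)"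
    using fin finite_separator[OF fin(3) NM] by simp_all
  have "model (P2 \<union> ?P) M" using M2 NM by (simp add: model_Un model_separator)
  \<comment> \<open>The context leaves only \<open>K = N\<close> among the pairs, which
    \<open>P2\<close> rejects, and no proper subset of \<open>M\<close> among the classical
    models.\<close>
  moreover have "\<not> ht_model (P2 \<union> ?P) K M \<and> \<not> model (P2 \<union> ?P) K" if "K \<subset> M" for K
  proof -
    have "K \<subseteq> M" "K \<noteq> M" using that by blast+
    then show ?thesis
      using not unfolding model_Un ht_model_Un
      by (metis NM model_separator ht_model_separator)
  qed
  ultimately have "min_answer_set (P2 \<union> ?P) M"
    unfolding min_answer_set_iff[OF finP(2)] by blast
  then have "min_answer_set (P1 \<union> ?P) M"
    using strongly_equivalent_minD[OF se finite_separator[OF fin(3) NM]] by blast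
  then have "\<not> ht_model (P1 \<union> ?P) N M"
    using \<open>N \<subset> M\<close> unfolding min_answer_set_iff[OF finP(1)] by blast
  then show False using ht NM by (simp add: ht_model_Un ht_model_separator)
qed

text \<open>A separating context must be finite, so an arbitrary pair is first cut down to the
  finite joint signature, outside which atoms do not matter to either program.\<close>

lemma strongly_equivalent_min_ht_model:
  assumes se: "strongly_equivalent_min P1 P2"
    and fin: "finite P1" "finite P2" and NM: "N \<subseteq> M" and ht: "ht_model P1 N M"
  shows "ht_model P2 N M"
proof -
  let ?S = "signature P1 \<union> signature P2"
  have 1: "ht_model P1 (N \<inter> ?S) (M \<inter> ?S) \<longleftrightarrow> ht_model P1 N M" by (rule ht_model_cong) auto
  have 2: "ht_model P2 (N \<inter> ?S) (M \<inter> ?S) \<longleftrightarrow> ht_model P2 N M" by (rule ht_model_cong) auto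
  have "finite (M \<inter> ?S)" using fin by (simp add: finite_signature)
  then have "ht_model P2 (N \<inter> ?S) (M \<inter> ?S)"
    using ht 1 NM by (intro strongly_equivalent_min_ht_model_finite[OF se fin]) auto
  then show ?thesis using 2 by simp
qed

theorem theorem5p6:
  fixes P1 P2 :: "'a form set"
  assumes "logic_program P1" and "logic_program P2"
  shows "strongly_equivalent_min P1 P2 \<longleftrightarrow> g3_equivalent P1 P2"
proof
  have fin: "finite P1" "finite P2" using assms by (simp_all add: logic_program_def)
  {
    assume "strongly_equivalent_min P1 P2"
    then show "g3_equivalent P1 P2"
      using strongly_equivalent_min_ht_model strongly_equivalent_min_sym fin
      unfolding g3_equivalent_iff[OF fin] by metis
  next
    assume "g3_equivalent P1 P2"
    then have ht: "ht_model P1 N M \<longleftrightarrow> ht_model P2 N M" if "N \<subseteq> M" for N M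
      using that by (simp add: g3_equivalent_iff[OF fin])
    \<comment> \<open>Classical models are the diagonal pairs \<open>(M, M)\<close>, so the
      three-valued equivalence also settles classical minimality.\<close>
    have m: "model P1 M \<longleftrightarrow> model P2 M" for M
      using ht[of M M] by (simp add: ht_model_refl)
    have "min_answer_set (P1 \<union> P) M \<longleftrightarrow> min_answer_set (P2 \<union> P) M" if "finite P" for P M
      using fin that ht m by (auto simp: min_answer_set_iff model_Un ht_model_Un)
    then show "strongly_equivalent_min P1 P2"
      by (simp add: strongly_equivalent_min_def logic_program_def)
  }
qed

end
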